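(* Consider matrices $\mathbf P_{ep}\in\mathbb R^{\tilde N_p\times M_p}$, $\mathbf P_{eq}\in\mathbb R^{\tilde N_q\times M_q}$, $\mathbf P_{fp}\in\mathbb R^{\tilde N_p\times N_p}$, $\mathbf P_{fq}\in\mathbb R^{\tilde N_q\times N_q}$, $\mathbf d_p\in\mathbb R^{N_p\times M_q}$, $\mathbf d_q\in\mathbb R^{N_q\times M_p}$, $\mathbf T_q\in\mathbb R^{M_b\times M_q}$, $\hat{\mathbf T}_p\in\mathbb R^{\hat M_b\times M_p}$, $\mathbf S_p\in\mathbb R^{M_b\times M_p}$, $\hat{\mathbf S}_q\in\mathbb R^{\hat M_b\times M_q}$ with $\tilde N_p+\tilde N_q+\hat M_b+M_b=M_p+M_q$, satisfying $$(-1)^r\mathbf d_p^T\mathbf P_{fp}^T\mathbf P_{ep}+\mathbf P_{eq}^T\mathbf P_{fq}\mathbf d_q+\mathbf T_q^T\mathbf S_p+\hat{\mathbf S}_q^T\hat{\mathbf T}_p=\mathbf 0,$$ $$\mathrm{rank}\begin{bmatrix}\mathbf P_{ep}\\ \hat{\mathbf T}_p\end{bmatrix}=M_p,\qquad\mathrm{rank}\begin{bmatrix}\mathbf P_{eq}\\ \mathbf T_q\end{bmatrix}=M_q.$$ Let $\bar D$ be the Dirac structure consisting of all pairs $(\bar{\mathbf f},\bar{\mathbf e})$, $\bar{\mathbf f}=(\tilde{\mathbf f}^p,\tilde{\mathbf f}^q,\hat{\mathbf f}^b,\mathbf f^b)$, $\bar{\mathbf e}=(\tilde{\mathbf e}^p,\tilde{\mathbf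 e}^q,\hat{\mathbf e}^b,\mathbf e^b)$, of the form $$\tilde{\mathbf f}^p=(-1)^r\mathbf P_{fp}\mathbf d_p\mathbf e^q,\quad\tilde{\mathbf f}^q=\mathbf P_{fq}\mathbf d_q\mathbf e^p,\quad\hat{\mathbf f}^b=\hat{\mathbf S}_q\mathbf e^q,\quad\mathbf f^b=\mathbf S_p\mathbf e^p,$$ $$\tilde{\mathbf e}^p=\mathbf P_{ep}\mathbf e^p,\quad\tilde{\mathbf e}^q=\mathbf P_{eq}\mathbf e^q,\quad\hat{\mathbf e}^b=\hat{\mathbf T}_p\mathbf e^p,\quad\mathbf e^b=\mathbf T_q\mathbf e^q,$$ with $\mathbf e^p\in\mathbb R^{M_p}$, $\mathbf e^q\in\mathbb R^{M_q}$. Then $\bar D$ admits an unconstrained input-output representation $$\begin{bmatrix}-\tilde{\mathbf f}^p\\-\tilde{\mathbf f}^q\end{bmatrix}=\underbrace{\begin{bmatrix}\mathbf 0&\mathbf J_p\\ \mathbf J_q&\mathbf 0\end{bmatrix}}_{\mathbf J=-\mathbf J^T}\begin{bmatrix}\tilde{\mathbf e}^p\\ \tilde{\mathbf e}^q\end{bmatrix}+\underbrace{\begin{bmatrix}\mathbf 0&\mathbf B_p\\ \mathbf B_q&\mathbf 0\end{bmatrix}}_{\mathbf B}\begin{bmatrix}\hat{\mathbf e}^b\\ \mathbf e^b\end{bmatrix},$$ $$\begin{bmatrix}\hat{\mathbf f}^b\\ \mathbf f^b\end{bmatrix}=\underbrace{\begin{bmatrix}\mathbf 0&\mathbf C_q\\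 \mathbf C_p&\mathbf 0\end{bmatrix}}_{\mathbf C=\mathbf B^T}\begin{bmatrix}\tilde{\mathbf e}^p\\ \tilde{\mathbf e}^q\end{bmatrix}+\underbrace{\begin{bmatrix}\mathbf 0&\mathbf D_q\\ \mathbf D_p&\mathbf 0\end{bmatrix}}_{\mathbf D=-\mathbf D^T}\begin{bmatrix}\hat{\mathbf e}^b\\ \mathbf e^b\end{bmatrix},$$ with $$\mathbf J_p=-\mathbf J_q^T,\qquad\mathbf B_p=\mathbf C_p^T,\quad\mathbf B_q=\mathbf C_q^T,\qquad\mathbf D_q=-\mathbf D_p^T.$$
   Context: All integers $N_p,N_q,M_p,M_q,M_b,\hat M_b,\tilde N_p,\tilde N_q$ are dimensions of discrete flow, effort, boundary port and minimal flow/effort vectors; $r=pq+1$ with degrees $p,q$ satisfying $p+q=n+1$. A Dirac structure on $\mathbb R^m\times\mathbb R^m$ with the Euclidean pairing $\langle\mathbf e|\mathbf f\rangle=\mathbf e^T\mathbf f$ is a linear subspace that is maximally isotropic under $\langle\langle(\mathbf f_1,\mathbf e_1),(\mathbf f_2,\mathbf e_2)\rangle\rangle=\tfrac12(\langle\mathbf e_1|\mathbf f_2\rangle+\langle\mathbf e_2|\mathbf f_1\rangle)$. "Admits an unconstrained input-output representation" means: there exist real matrices $\mathbf J_p,\mathbf J_q,\mathbf B_p,\mathbf B_q,\mathbf C_p,\mathbf C_q,\mathbf D_p,\mathbf D_q$ of appropriate sizes, with the indicated symmetries, such that $\bar D$ is exactly the set of all pairs $(\bar{\mathbf f},\bar{\mathbf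 e})$ satisfying the displayed linear equations, with $\bar{\mathbf e}=(\tilde{\mathbf e}^p,\tilde{\mathbf e}^q,\hat{\mathbf e}^b,\mathbf e^b)\in\mathbb R^{\tilde N_p+\tilde N_q+\hat M_b+M_b}$ arbitrary. *)

theory Defs
  imports "Jordan_Normal_Form.DL_Rank"
begin

type_synonym flow_effort = "real vec \<times> real vec"

definition symm_pairing :: "flow_effort \<Rightarrow> flow_effort \<Rightarrow> real" where
  "symm_pairing x y = (1/2) * (snd x \<bullet> fst y + snd y \<bullet> fst x)"

definition linear_subspace :: "nat \<Rightarrow> flow_effort set \<Rightarrow> bool" where
  "linear_subspace m D \<longleftrightarrow>
     D \<subseteq> carrier_vec m \<times> carrier_vec m \<and>
     (0\<^sub>v m, 0\<^sub>v m) \<in> D \<and>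
     (\<forall>f1 e1 f2 e2. (f1, e1) \<in> D \<longrightarrow> (f2, e2) \<in> D \<longrightarrow> (f1 + f2, e1 + e2) \<in> D) \<and>
     (\<forall>c f e. (f, e) \<in> D \<longrightarrow> (c \<cdot>\<^sub>v f, c \<cdot>\<^sub>v e) \<in> D)"

definition isotropic :: "flow_effort set \<Rightarrow> bool" where
  "isotropic D \<longleftrightarrow> (\<forall>x\<in>D. \<forall>y\<in>D. symm_pairing x y = 0)"

definition dirac_structure :: "nat \<Rightarrow> flow_effort set \<Rightarrow> bool" where
  "dirac_structure m D \<longleftrightarrow>
     linear_subspace m D \<and> isotropic D \<and>
     (\<forall>D'. linear_subspace m D' \<longrightarrow> isotropic D' \<longrightarrow> D \<subseteq> D' \<longrightarrow> D' = D)"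

text \<open>The suffix \<open>h\<close> marks the hatted boundary variables. The efforts range over the whole
  space \<open>\<real>^(np + nq + mbh + mb)\<close> (no constraint besides the two displayed equations).\<close>

definition io_structure ::
  "nat \<Rightarrow> nat \<Rightarrow> nat \<Rightarrow> nat \<Rightarrow> real mat \<Rightarrow> real mat \<Rightarrow> real mat \<Rightarrow> real mat \<Rightarrow> flow_effort set" where
  "io_structure np nq mbh mb J B C D =
     {(fp @\<^sub>v fq @\<^sub>v fbh @\<^sub>v fb, ep @\<^sub>v eq @\<^sub>v ebh @\<^sub>v eb) | fp fq fbh fb ep eq ebh eb.
        fp \<in> carrier_vec np \<and> fq \<in> carrier_vec nq \<and>
        fbh \<in> carrier_vec mbh \<and> fb \<in> carrier_vec mb \<and>
        ep \<in> carrier_vec np \<and> eq \<in> carrier_vec nq \<and>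
        ebh \<in> carrier_vec mbh \<and> eb \<in> carrier_vec mb \<and>
        (- fp) @\<^sub>v (- fq) = J *\<^sub>v (ep @\<^sub>v eq) + B *\<^sub>v (ebh @\<^sub>v eb) \<and>
        fbh @\<^sub>v fb = C *\<^sub>v (ep @\<^sub>v eq) + D *\<^sub>v (ebh @\<^sub>v eb)}"

end

theory Submission
  imports Defs
begin

text \<open>
  Stack the effort maps of each side into one matrix, \<open>E = [P\<^sub>e\<^sub>p; T\<^sub>p]\<close> acting on \<open>e\<^sup>p\<close> and
  \<open>G = [P\<^sub>e\<^sub>q; T\<^sub>q]\<close> acting on \<open>e\<^sup>q\<close>, and stack the flow maps as
  \<open>A = [(-1)\<^sup>r P\<^sub>f\<^sub>p d\<^sub>p; S\<^sub>q]\<close> acting on \<open>e\<^sup>q\<close> and \<open>B = [P\<^sub>f\<^sub>q d\<^sub>q; S\<^sub>p]\<close> acting on \<open>e\<^sup>p\<close>.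
  The rank conditions and the dimension count make \<open>E\<close> and \<open>G\<close> square, hence invertible, so
  the efforts can replace \<open>e\<^sup>p\<close> and \<open>e\<^sup>q\<close> as free coordinates. The structural
  identity is exactly \<open>A\<^sup>T E + G\<^sup>T B = 0\<close>. Hence \<open>K = A G\<inverse>\<close>
  satisfies \<open>A = K G\<close> and \<open>B = - K\<^sup>T E\<close> (lemma \<open>coupling_matrix\<close>): the efforts on the
  \<open>q\<close> side determine the flows dual to the \<open>p\<close> side through \<open>K\<close>, and conversely through
  \<open>- K\<^sup>T\<close>. Splitting \<open>K\<close> into interior and boundary blocks gives

  \<open>J\<^sub>p = - K\<^sub>1\<^sub>1, B\<^sub>p = - K\<^sub>1\<^sub>2, C\<^sub>q = K\<^sub>2\<^sub>1, D\<^sub>q = K\<^sub>2\<^sub>2\<close>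

  together with the transposed blocks that the symmetries prescribe.

  The Dirac property follows from the same data: every pair in the structure has
  \<open>\<langle>e|f\<rangle> = 0\<close>, since the contributions of \<open>K\<close> and \<open>- K\<^sup>T\<close> cancel, and every effort vector
  occurs. These two properties already force maximal isotropy (lemma \<open>dirac_structureI\<close>).
\<close>

section \<open>Full-rank square matrices and stacked matrices\<close>

lemma (in vec_space) rank_le_dim_row:
  assumes "A \<in> carrier_mat n nc"
  shows "rank A \<le> n"
proof -
  obtain S where S: "maximal S (\<lambda>T. T \<subseteq> set (cols A) \<and> lin_indpt T)"
    using maximal_exists[of "\<lambda>T. T \<subseteq> set (cols A) \<and> lin_indpt T" "card (set (cols A))" "{}"]
    by (metis List.finite_set card_mono empty_iff empty_subsetI finite.emptyI finite_lin_indpt2 rev_finite_subset)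
  have "S \<subseteq> carrier_vec n" "lin_indpt S"
    using S cols_dim[of A] assms unfolding maximal_def by auto
  then show ?thesis
    using rank_card_indpt[OF assms S] li_le_dim(2)[of S] dim_is_n by (simp add: fin_dim)
qed

lemma full_rank_square_inverse:
  fixes A :: "real mat"
  assumes A: "A \<in> carrier_mat n n" and "vec_space.rank n A = n"
  obtains B where "B \<in> carrier_mat n n" "A * B = 1\<^sub>m n" "B * A = 1\<^sub>m n"
proof -
  have "det A \<noteq> 0"
    using assms vec_space.det_rank_iff[OF A] by simp
  from det_non_zero_imp_unit[OF A this, of "()"] show ?thesis
    using that unfolding Units_def ring_mat_def by auto
qed

lemma transpose_append_rows_mult:
  fixes A1 A2 B1 B2 :: "'a :: comm_ring_1 mat"
  assumes "A1 \<in> carrier_mat n1 k" "A2 \<in> carrier_mat n2 k"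
    and "B1 \<in> carrier_mat n1 m" "B2 \<in> carrier_mat n2 m"
  shows "transpose_mat (A1 @\<^sub>r A2) * (B1 @\<^sub>r B2) = transpose_mat A1 * B1 + transpose_mat A2 * B2"
proof (rule eq_matI)
  have col: "col (X1 @\<^sub>r X2) i = col X1 i @\<^sub>v col X2 i"
    if "X1 \<in> carrier_mat n1 l" "X2 \<in> carrier_mat n2 l" "i < l" for X1 X2 :: "'a mat" and i l
    using that by (intro eq_vecI) (auto simp: append_rows_def)
  fix i j
  assume "i < dim_row (transpose_mat A1 * B1 + transpose_mat A2 * B2)"
    and "j < dim_col (transpose_mat A1 * B1 + transpose_mat A2 * B2)"
  then have ij: "i < k" "j < m" using assms by auto
  have "(transpose_mat (A1 @\<^sub>r A2) * (B1 @\<^sub>r B2)) $$ (i, j)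
      = col (A1 @\<^sub>r A2) i \<bullet> col (B1 @\<^sub>r B2) j"
    using assms ij by (auto simp: append_rows_def)
  also have "\<dots> = col A1 i \<bullet> col B1 j + col A2 i \<bullet> col B2 j"
    unfolding col[OF assms(1,2) ij(1)] col[OF assms(3,4) ij(2)]
    using assms by (intro scalar_prod_append[of _ n1 _ n2]) auto
  finally show "(transpose_mat (A1 @\<^sub>r A2) * (B1 @\<^sub>r B2)) $$ (i, j)
      = (transpose_mat A1 * B1 + transpose_mat A2 * B2) $$ (i, j)"
    using assms ij by auto
qed (use assms in \<open>auto simp: append_rows_def\<close>)

lemma smult_append_vec: "c \<cdot>\<^sub>v (v @\<^sub>v w) = (c \<cdot>\<^sub>v v) @\<^sub>v (c \<cdot>\<^sub>v w)"
  by (rule eq_vecI) auto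

lemma uminus_append_vec: "- (v @\<^sub>v w) = (- v) @\<^sub>v (- w)" for v w :: "'a :: group_add vec"
  by (rule eq_vecI) auto

lemma uminus_four_block_mat:
  fixes A :: "'a :: group_add mat"
  assumes "A \<in> carrier_mat nr1 nc1" "B \<in> carrier_mat nr1 nc2"
    and "C \<in> carrier_mat nr2 nc1" "D \<in> carrier_mat nr2 nc2"
  shows "- four_block_mat A B C D = four_block_mat (- A) (- B) (- C) (- D)"
  using assms by (intro eq_matI) auto

section \<open>A criterion for Dirac structures\<close>

text \<open>Isotropy follows from \<open>null\<close> by polarization. For maximality, a pair in a larger isotropic
  subspace differs from a pair in \<open>D\<close> with the same effort by a pure flow, which is
  orthogonal to all efforts of \<open>D\<close>, that is, to the whole space.\<close>

lemma dirac_structureI: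
  assumes sub: "linear_subspace m D"
    and null: "\<And>f e. (f, e) \<in> D \<Longrightarrow> e \<bullet> f = 0"
    and total: "\<And>e. e \<in> carrier_vec m \<Longrightarrow> \<exists>f. (f, e) \<in> D"
  shows "dirac_structure m D"
proof -
  have car: "f \<in> carrier_vec m" "e \<in> carrier_vec m" if "(f, e) \<in> X" "linear_subspace m X" for f e X
    using that unfolding linear_subspace_def by auto
  have "e1 \<bullet> f2 + e2 \<bullet> f1 = 0" if a: "(f1, e1) \<in> D" "(f2, e2) \<in> D" for f1 e1 f2 e2
  proof -
    note c = car[OF a(1) sub] car[OF a(2) sub]
    have "(f1 + f2, e1 + e2) \<in> D"
      using a sub unfolding linear_subspace_def by blast
    then have "0 = (e1 + e2) \<bullet> (f1 + f2)" using null by simp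
    also have "\<dots> = e1 \<bullet> f1 + e1 \<bullet> f2 + (e2 \<bullet> f1 + e2 \<bullet> f2)"
      using c by (simp add: add_scalar_prod_distrib[of _ m] scalar_prod_add_distrib[of _ m])
    finally show ?thesis using null[OF a(1)] null[OF a(2)] by simp
  qed
  then have iso: "isotropic D"
    unfolding isotropic_def symm_pairing_def by auto
  have "D' \<subseteq> D" if D': "linear_subspace m D'" "isotropic D'" "D \<subseteq> D'" for D'
  proof (rule subrelI)
    fix f e assume fe: "(f, e) \<in> D'"
    note cfe = car[OF fe D'(1)]
    obtain g where g: "(g, e) \<in> D" using total cfe by blast
    note cg = car[OF g sub]
    have "((-1) \<cdot>\<^sub>v g, (-1) \<cdot>\<^sub>v e) \<in> D'"
      using g D' unfolding linear_subspace_def by blast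
    then have d: "(f + (-1) \<cdot>\<^sub>v g, e + (-1) \<cdot>\<^sub>v e) \<in> D'"
      using fe D'(1) unfolding linear_subspace_def by blast
    let ?d = "f + (-1) \<cdot>\<^sub>v g"
    have e0: "e + (-1) \<cdot>\<^sub>v e = 0\<^sub>v m" using cfe by (intro eq_vecI) auto
    have cd: "?d \<in> carrier_vec m" using cfe cg by simp
    \<comment> \<open>The flow difference itself occurs as an effort, so it is orthogonal to itself.\<close>
    obtain h where h: "(h, ?d) \<in> D" using total[OF cd] by blast
    have "symm_pairing (?d, 0\<^sub>v m) (h, ?d) = 0"
      using d h D' unfolding isotropic_def e0 by blast
    then have "?d \<bullet> ?d = 0"
      using car[OF h sub] by (simp add: symm_pairing_def)
    then have "\<forall>i < m. ?d $ i = 0"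
      using cd by (auto simp: scalar_prod_def sum_nonneg_eq_0_iff simp del: index_add_vec)
    then have z: "?d = 0\<^sub>v m"
      using cd cfe cg by (intro eq_vecI) auto
    have "f = g"
    proof (rule eq_vecI)
      fix i assume "i < dim_vec g"
      with arg_cong[OF z, of "\<lambda>v. v $ i"] cfe cg show "f $ i = g $ i" by auto
    qed (use cfe cg in auto)
    with g show "(f, e) \<in> D" by simp
  qed
  with sub iso show ?thesis unfolding dirac_structure_def by blast
qed

section \<open>The coupling matrix\<close>

text \<open>With \<open>G\<close> invertible, the skew relation lets the two flow maps \<open>A\<close> and \<open>B\<close> factor through the
  effort maps by one matrix \<open>K = A G\<inverse>\<close> and its negative transpose.\<close>

lemma coupling_matrix:
  fixes E G A B :: "real mat"
  assumes E: "E \<in> carrier_mat m m" and G: "G \<in> carrier_mat k k"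
    and A: "A \<in> carrier_mat m k" and B: "B \<in> carrier_mat k m"
    and G': "G' \<in> carrier_mat k k" "G * G' = 1\<^sub>m k" "G' * G = 1\<^sub>m k"
    and skew: "transpose_mat A * E + transpose_mat G * B = 0\<^sub>m k m"
  obtains K where "K \<in> carrier_mat m k" "K * G = A" "B = - (transpose_mat K * E)"
proof
  show "A * G' \<in> carrier_mat m k" using A G' by simp
  show "A * G' * G = A" using A G G' by (simp add: assoc_mult_mat[OF A G'(1) G])
  have t: "transpose_mat G' \<in> carrier_mat k k" "transpose_mat G \<in> carrier_mat k k"
    "transpose_mat A \<in> carrier_mat k m"
    using A G G' by auto
  have AE: "transpose_mat A * E = - (transpose_mat G * B)"
  proof (rule eq_matI)
    fix i j assume "i < dim_row (- (transpose_mat G * B))" "j < dim_col (- (transpose_mat G * B))"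
    then have ij: "i < k" "j < m" using G B by auto
    have "(transpose_mat A * E) $$ (i, j) + (transpose_mat G * B) $$ (i, j)
        = (transpose_mat A * E + transpose_mat G * B) $$ (i, j)"
      using ij G B by (intro index_add_mat(1)[symmetric]) auto
    then show "(transpose_mat A * E) $$ (i, j) = (- (transpose_mat G * B)) $$ (i, j)"
      unfolding skew using ij G B by auto
  qed (use A E G B in auto)
  have "transpose_mat (A * G') * E = transpose_mat G' * (transpose_mat A * E)"
    using assoc_mult_mat[OF t(1,3) E] by (simp add: transpose_mult[OF A G'(1)])
  also have "\<dots> = - (transpose_mat G' * (transpose_mat G * B))"
    unfolding AE using G G' B by (intro uminus_mult_right_mat) auto
  also have "transpose_mat G' * (transpose_mat G * B) = transpose_mat (G * G') * B"
    using assoc_mult_mat[OF t(1,2) B] by (simp add: transpose_mult[OF G G'(1)])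
  also have "\<dots> = B" using G'(2) B by simp
  finally show "B = - (transpose_mat (A * G') * E)" by simp
qed

section \<open>Flow-effort pairs coupled by a matrix and its negative transpose\<close>

text \<open>Two parameter vectors \<open>u\<close> and \<open>v\<close> generate the efforts: \<open>[Ep; Tp]\<close> maps \<open>u\<close> and \<open>[Eq; Tq]\<close>
  maps \<open>v\<close> onto all interior and boundary efforts. The flows \<open>Fp, Sq\<close> dual to the efforts of
  \<open>u\<close> are obtained from the efforts of \<open>v\<close> by the block matrix \<open>K\<close> with blocks \<open>K11, K12, K21,
  K22\<close>, and the flows \<open>Fq, Sp\<close> dual to the efforts of \<open>v\<close> from the efforts of \<open>u\<close> by \<open>- K\<^sup>T\<close>.\<close>

locale coupled_ports =
  fixes np nq mh mb Mp Mq :: nat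
    and Fp Fq Sq Sp Ep Eq Tp Tq K11 K12 K21 K22 :: "real mat"
  assumes carriers:
    "Fp \<in> carrier_mat np Mq" "Fq \<in> carrier_mat nq Mp" "Sq \<in> carrier_mat mh Mq" "Sp \<in> carrier_mat mb Mp"
    "Ep \<in> carrier_mat np Mp" "Eq \<in> carrier_mat nq Mq" "Tp \<in> carrier_mat mh Mp" "Tq \<in> carrier_mat mb Mq"
    "K11 \<in> carrier_mat np nq" "K12 \<in> carrier_mat np mb" "K21 \<in> carrier_mat mh nq" "K22 \<in> carrier_mat mh mb"
    and surj_p: "x1 \<in> carrier_vec np \<Longrightarrow> x2 \<in> carrier_vec mh \<Longrightarrow>
      \<exists>u \<in> carrier_vec Mp. Ep *\<^sub>v u = x1 \<and> Tp *\<^sub>v u = x2"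
    and surj_q: "y1 \<in> carrier_vec nq \<Longrightarrow> y2 \<in> carrier_vec mb \<Longrightarrow>
      \<exists>v \<in> carrier_vec Mq. Eq *\<^sub>v v = y1 \<and> Tq *\<^sub>v v = y2"
    and Fp: "v \<in> carrier_vec Mq \<Longrightarrow> Fp *\<^sub>v v = K11 *\<^sub>v (Eq *\<^sub>v v) + K12 *\<^sub>v (Tq *\<^sub>v v)"
    and Sq: "v \<in> carrier_vec Mq \<Longrightarrow> Sq *\<^sub>v v = K21 *\<^sub>v (Eq *\<^sub>v v) + K22 *\<^sub>v (Tq *\<^sub>v v)"
    and Fq: "u \<in> carrier_vec Mp \<Longrightarrow>
      Fq *\<^sub>v u = - (transpose_mat K11 *\<^sub>v (Ep *\<^sub>v u) + transpose_mat K21 *\<^sub>v (Tp *\<^sub>v u))"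
    and Sp: "u \<in> carrier_vec Mp \<Longrightarrow>
      Sp *\<^sub>v u = - (transpose_mat K12 *\<^sub>v (Ep *\<^sub>v u) + transpose_mat K22 *\<^sub>v (Tp *\<^sub>v u))"
begin

text \<open>The flow-effort pairs in image representation. The four components are ordered as interior
  \<open>p\<close>, interior \<open>q\<close>, boundary effort generated by \<open>u\<close>, boundary effort generated by \<open>v\<close>; in each
  slot the flow depends on the parameter that does not generate the effort.\<close>

definition pairs :: "flow_effort set" where
  "pairs = {((Fp *\<^sub>v v) @\<^sub>v (Fq *\<^sub>v u) @\<^sub>v (Sq *\<^sub>v v) @\<^sub>v (Sp *\<^sub>v u),
             (Ep *\<^sub>v u) @\<^sub>v (Eq *\<^sub>v v) @\<^sub>v (Tp *\<^sub>v u) @\<^sub>v (Tq *\<^sub>v v)) | u v.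
             u \<in> carrier_vec Mp \<and> v \<in> carrier_vec Mq}"

lemma prod_carriers:
  "v \<in> carrier_vec Mq \<Longrightarrow> Fp *\<^sub>v v \<in> carrier_vec np" "u \<in> carrier_vec Mp \<Longrightarrow> Fq *\<^sub>v u \<in> carrier_vec nq"
  "v \<in> carrier_vec Mq \<Longrightarrow> Sq *\<^sub>v v \<in> carrier_vec mh" "u \<in> carrier_vec Mp \<Longrightarrow> Sp *\<^sub>v u \<in> carrier_vec mb"
  "u \<in> carrier_vec Mp \<Longrightarrow> Ep *\<^sub>v u \<in> carrier_vec np" "v \<in> carrier_vec Mq \<Longrightarrow> Eq *\<^sub>v v \<in> carrier_vec nq"
  "u \<in> carrier_vec Mp \<Longrightarrow> Tp *\<^sub>v u \<in> carrier_vec mh" "v \<in> carrier_vec Mq \<Longrightarrow> Tq *\<^sub>v v \<in> carrier_vec mb"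
  using carriers by auto

lemma append4_carrier:
  assumes "a \<in> carrier_vec np" "b \<in> carrier_vec nq" "c \<in> carrier_vec mh" "d \<in> carrier_vec mb"
  shows "a @\<^sub>v b @\<^sub>v c @\<^sub>v d \<in> carrier_vec (np + nq + mh + mb)"
  using append_carrier_vec[OF assms(1) append_carrier_vec[OF assms(2)
        append_carrier_vec[OF assms(3,4)]]]
  by (simp add: add.assoc)

lemma append4_cases:
  assumes "e \<in> carrier_vec (np + nq + mh + mb)"
  obtains a b c d where "e = a @\<^sub>v b @\<^sub>v c @\<^sub>v d"
    "a \<in> carrier_vec np" "b \<in> carrier_vec nq" "c \<in> carrier_vec mh" "d \<in> carrier_vec mb"
proof
  let ?t = "vec_last e (nq + mh + mb)"
  let ?s = "vec_last ?t (mh + mb)"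
  have "e = vec_first e np @\<^sub>v ?t"
    using assms by (simp add: add.assoc)
  also have "?t = vec_first ?t nq @\<^sub>v ?s"
    by (simp add: add.assoc)
  also have "?s = vec_first ?s mh @\<^sub>v vec_last ?s mb"
    by simp
  finally show "e = vec_first e np @\<^sub>v vec_first ?t nq @\<^sub>v vec_first ?s mh @\<^sub>v vec_last ?s mb" .
qed auto

lemma append4_add:
  assumes "a \<in> carrier_vec np" "b \<in> carrier_vec nq" "c \<in> carrier_vec mh" "d \<in> carrier_vec mb"
    "a' \<in> carrier_vec np" "b' \<in> carrier_vec nq" "c' \<in> carrier_vec mh" "d' \<in> carrier_vec mb"
  shows "(a @\<^sub>v b @\<^sub>v c @\<^sub>v d) + (a' @\<^sub>v b' @\<^sub>v c' @\<^sub>v d')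
    = (a + a') @\<^sub>v (b + b') @\<^sub>v (c + c') @\<^sub>v (d + d')"
  using assms by (simp add: append_vec_add[of _ np _ _ "nq + (mh + mb)"]
      append_vec_add[of _ nq _ _ "mh + mb"] append_vec_add[of _ mh _ _ mb])

lemma pairs_linear: "linear_subspace (np + nq + mh + mb) pairs"
  unfolding linear_subspace_def
proof (intro conjI allI impI)
  show "pairs \<subseteq> carrier_vec (np + nq + mh + mb) \<times> carrier_vec (np + nq + mh + mb)"
    unfolding pairs_def by (auto intro!: append4_carrier prod_carriers)
next
  have z: "A *\<^sub>v 0\<^sub>v l = 0\<^sub>v k" if "A \<in> carrier_mat k l" for A :: "real mat" and k l
    using that by (intro eq_vecI) auto
  have "0\<^sub>v (np + nq + mh + mb) = 0\<^sub>v np @\<^sub>v 0\<^sub>v nq @\<^sub>v 0\<^sub>v mh @\<^sub>v (0\<^sub>v mb :: real vec)"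
    by (intro eq_vecI) auto
  then show "(0\<^sub>v (np + nq + mh + mb), 0\<^sub>v (np + nq + mh + mb)) \<in> pairs"
    unfolding pairs_def
    by (intro CollectI exI[of _ "0\<^sub>v Mp"] exI[of _ "0\<^sub>v Mq"]) (simp add: carriers[THEN z])
next
  fix f1 e1 f2 e2 assume "(f1, e1) \<in> pairs" "(f2, e2) \<in> pairs"
  then obtain u v u' v' where uv: "u \<in> carrier_vec Mp" "v \<in> carrier_vec Mq"
      "u' \<in> carrier_vec Mp" "v' \<in> carrier_vec Mq"
    and "f1 = (Fp *\<^sub>v v) @\<^sub>v (Fq *\<^sub>v u) @\<^sub>v (Sq *\<^sub>v v) @\<^sub>v (Sp *\<^sub>v u)"
        "e1 = (Ep *\<^sub>v u) @\<^sub>v (Eq *\<^sub>v v) @\<^sub>v (Tp *\<^sub>v u) @\<^sub>v (Tq *\<^sub>v v)"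
        "f2 = (Fp *\<^sub>v v') @\<^sub>v (Fq *\<^sub>v u') @\<^sub>v (Sq *\<^sub>v v') @\<^sub>v (Sp *\<^sub>v u')"
        "e2 = (Ep *\<^sub>v u') @\<^sub>v (Eq *\<^sub>v v') @\<^sub>v (Tp *\<^sub>v u') @\<^sub>v (Tq *\<^sub>v v')"
    unfolding pairs_def by auto
  then show "(f1 + f2, e1 + e2) \<in> pairs"
    unfolding pairs_def
    by (intro CollectI exI[of _ "u + u'"] exI[of _ "v + v'"])
      (simp add: append4_add prod_carriers carriers[THEN mult_add_distrib_mat_vec])
next
  fix c f e assume "(f, e) \<in> pairs"
  then obtain u v where uv: "u \<in> carrier_vec Mp" "v \<in> carrier_vec Mq"
    and "f = (Fp *\<^sub>v v) @\<^sub>v (Fq *\<^sub>v u) @\<^sub>v (Sq *\<^sub>v v) @\<^sub>v (Sp *\<^sub>v u)"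
        "e = (Ep *\<^sub>v u) @\<^sub>v (Eq *\<^sub>v v) @\<^sub>v (Tp *\<^sub>v u) @\<^sub>v (Tq *\<^sub>v v)"
    unfolding pairs_def by auto
  then show "(c \<cdot>\<^sub>v f, c \<cdot>\<^sub>v e) \<in> pairs"
    unfolding pairs_def
    by (intro CollectI exI[of _ "c \<cdot>\<^sub>v u"] exI[of _ "c \<cdot>\<^sub>v v"])
      (simp add: smult_append_vec carriers[THEN mult_mat_vec])
qed

lemma pairs_null:
  assumes "(f, e) \<in> pairs"
  shows "e \<bullet> f = 0"
proof -
  obtain u v where uv: "u \<in> carrier_vec Mp" "v \<in> carrier_vec Mq"
    and f: "f = (Fp *\<^sub>v v) @\<^sub>v (Fq *\<^sub>v u) @\<^sub>v (Sq *\<^sub>v v) @\<^sub>v (Sp *\<^sub>v u)"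
    and e: "e = (Ep *\<^sub>v u) @\<^sub>v (Eq *\<^sub>v v) @\<^sub>v (Tp *\<^sub>v u) @\<^sub>v (Tq *\<^sub>v v)"
    using assms unfolding pairs_def by auto
  define x1 x2 y1 y2 where xy: "x1 = Ep *\<^sub>v u" "x2 = Tp *\<^sub>v u" "y1 = Eq *\<^sub>v v" "y2 = Tq *\<^sub>v v"
  have c: "x1 \<in> carrier_vec np" "x2 \<in> carrier_vec mh" "y1 \<in> carrier_vec nq" "y2 \<in> carrier_vec mb"
    unfolding xy using uv prod_carriers by auto
  have tr: "y \<bullet> (transpose_mat K *\<^sub>v x) = x \<bullet> (K *\<^sub>v y)"
    if "K \<in> carrier_mat a b" "x \<in> carrier_vec a" "y \<in> carrier_vec b" for K :: "real mat" and a b x y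
    using transpose_vec_mult_scalar[OF that(1,3,2)] that
    by (metis comm_scalar_prod mult_mat_vec_carrier transpose_carrier_mat)
  have split: "x \<bullet> (K *\<^sub>v y + L *\<^sub>v z) = x \<bullet> (K *\<^sub>v y) + x \<bullet> (L *\<^sub>v z)"
    if "x \<in> carrier_vec a" "K \<in> carrier_mat a b" "L \<in> carrier_mat a c" "y \<in> carrier_vec b" "z \<in> carrier_vec c"
    for K L :: "real mat" and a b c x y z
    using that by (intro scalar_prod_add_distrib) auto
  have "e \<bullet> f = x1 \<bullet> (Fp *\<^sub>v v) + (y1 \<bullet> (Fq *\<^sub>v u) + (x2 \<bullet> (Sq *\<^sub>v v) + y2 \<bullet> (Sp *\<^sub>v u)))"
    unfolding e f xy using uv
    by (simp add: prod_carriers scalar_prod_append[of _ np _ "nq + (mh + mb)"]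
        scalar_prod_append[of _ nq _ "mh + mb"] scalar_prod_append[of _ mh _ mb])
  also have "\<dots> = 0"
    unfolding Fp[OF uv(2)] Sq[OF uv(2)] Fq[OF uv(1)] Sp[OF uv(1)] xy[symmetric]
    using carriers(9-12) c
    by (simp add: split[of _ np _ nq _ mb] split[of _ mh _ nq _ mb]
        split[of _ nq _ np _ mh] split[of _ mb _ np _ mh] tr[of _ np nq] tr[of _ np mb] tr[of _ mh nq] tr[of _ mh mb])
  finally show ?thesis .
qed

lemma pairs_dirac: "dirac_structure (np + nq + mh + mb) pairs"
proof (rule dirac_structureI[OF pairs_linear pairs_null])
  fix e :: "real vec" assume "e \<in> carrier_vec (np + nq + mh + mb)"
  then obtain a b c d where e: "e = a @\<^sub>v b @\<^sub>v c @\<^sub>v d"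
    and "a \<in> carrier_vec np" "b \<in> carrier_vec nq" "c \<in> carrier_vec mh" "d \<in> carrier_vec mb"
    by (rule append4_cases)
  then obtain u v where "u \<in> carrier_vec Mp" "Ep *\<^sub>v u = a" "Tp *\<^sub>v u = c"
    and "v \<in> carrier_vec Mq" "Eq *\<^sub>v v = b" "Tq *\<^sub>v v = d"
    using surj_p[of a c] surj_q[of b d] by auto
  then show "\<exists>f. (f, e) \<in> pairs"
    unfolding pairs_def e by blast
qed

text \<open>At an effort generated by \<open>u\<close> and \<open>v\<close>, the input-output equations single out exactly the flow
  that \<open>u\<close> and \<open>v\<close> generate. The minus signs of the upper blocks come from the left-hand
  side \<open>(- fp, - fq)\<close>.\<close>

lemma io_equations_iff:
  assumes "fp \<in> carrier_vec np" "fq \<in> carrier_vec nq" "fh \<in> carrier_vec mh" "fb \<in> carrier_vec mb"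
    and e: "u \<in> carrier_vec Mp" "v \<in> carrier_vec Mq"
  shows "((- fp) @\<^sub>v (- fq) =
        four_block_mat (0\<^sub>m np np) (- K11) (transpose_mat K11) (0\<^sub>m nq nq) *\<^sub>v ((Ep *\<^sub>v u) @\<^sub>v (Eq *\<^sub>v v))
        + four_block_mat (0\<^sub>m np mh) (- K12) (transpose_mat K21) (0\<^sub>m nq mb) *\<^sub>v ((Tp *\<^sub>v u) @\<^sub>v (Tq *\<^sub>v v)) \<and>
      fh @\<^sub>v fb =
        four_block_mat (0\<^sub>m mh np) K21 (- transpose_mat K12) (0\<^sub>m mb nq) *\<^sub>v ((Ep *\<^sub>v u) @\<^sub>v (Eq *\<^sub>v v))
        + four_block_mat (0\<^sub>m mh mh) K22 (- transpose_mat K22) (0\<^sub>m mb mb) *\<^sub>v ((Tp *\<^sub>v u) @\<^sub>v (Tq *\<^sub>v v)))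
    \<longleftrightarrow> fp = Fp *\<^sub>v v \<and> fq = Fq *\<^sub>v u \<and> fh = Sq *\<^sub>v v \<and> fb = Sp *\<^sub>v u" (is "?l1 = ?r1 \<and> ?l2 = ?r2 \<longleftrightarrow> _")
proof -
  have minus: "- (x + y) = - x + - y" if "x \<in> carrier_vec k" "y \<in> carrier_vec k" for x y :: "real vec" and k
    using that by (intro eq_vecI) auto
  have zero: "0\<^sub>m k l *\<^sub>v x = 0\<^sub>v k" if "x \<in> carrier_vec l" for x :: "real vec" and k l
    using that by (intro eq_vecI) auto
  have "?r1 = (- (Fp *\<^sub>v v)) @\<^sub>v (- (Fq *\<^sub>v u))"
    unfolding Fp[OF e(2)] Fq[OF e(1)] using carriers prod_carriers e
    by (simp add: four_block_mat_mult_vec[of _ np np _ nq _ nq] four_block_mat_mult_vec[of _ np mh _ mb _ nq]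
        append_vec_add[of _ np _ _ nq] minus[of _ np] zero)
  moreover have "?r2 = (Sq *\<^sub>v v) @\<^sub>v (Sp *\<^sub>v u)"
    unfolding Sq[OF e(2)] Sp[OF e(1)] using carriers prod_carriers e
    by (simp add: four_block_mat_mult_vec[of _ mh np _ nq _ mb] four_block_mat_mult_vec[of _ mh mh _ mb _ mb]
        append_vec_add[of _ mh _ _ mb] minus[of _ mb] zero)
  ultimately show ?thesis
    using assms prod_carriers by (auto simp: append_vec_eq[of _ np] append_vec_eq[of _ mh])
qed

lemma pairs_eq_io_structure:
  "pairs = io_structure np nq mh mb
     (four_block_mat (0\<^sub>m np np) (- K11) (transpose_mat K11) (0\<^sub>m nq nq))
     (four_block_mat (0\<^sub>m np mh) (- K12) (transpose_mat K21) (0\<^sub>m nq mb))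
     (four_block_mat (0\<^sub>m mh np) K21 (- transpose_mat K12) (0\<^sub>m mb nq))
     (four_block_mat (0\<^sub>m mh mh) K22 (- transpose_mat K22) (0\<^sub>m mb mb))"
  (is "_ = io_structure _ _ _ _ ?J ?B ?C ?D")
proof (intro equalityI subrelI)
  fix f e assume "(f, e) \<in> pairs"
  then obtain u v where uv: "u \<in> carrier_vec Mp" "v \<in> carrier_vec Mq"
    and fe: "f = (Fp *\<^sub>v v) @\<^sub>v (Fq *\<^sub>v u) @\<^sub>v (Sq *\<^sub>v v) @\<^sub>v (Sp *\<^sub>v u)"
        "e = (Ep *\<^sub>v u) @\<^sub>v (Eq *\<^sub>v v) @\<^sub>v (Tp *\<^sub>v u) @\<^sub>v (Tq *\<^sub>v v)"
    unfolding pairs_def by auto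
  note c = prod_carriers(1,3,6,8)[OF uv(2)] prod_carriers(2,4,5,7)[OF uv(1)]
  show "(f, e) \<in> io_structure np nq mh mb ?J ?B ?C ?D"
    unfolding io_structure_def fe
    using c io_equations_iff[OF c(1,5,2,6) uv] by blast
next
  fix f e assume "(f, e) \<in> io_structure np nq mh mb ?J ?B ?C ?D"
  then obtain fp fq fh fb a b c d where
    fe: "f = fp @\<^sub>v fq @\<^sub>v fh @\<^sub>v fb" "e = a @\<^sub>v b @\<^sub>v c @\<^sub>v d"
    and cf: "fp \<in> carrier_vec np" "fq \<in> carrier_vec nq" "fh \<in> carrier_vec mh" "fb \<in> carrier_vec mb"
    and ce: "a \<in> carrier_vec np" "b \<in> carrier_vec nq" "c \<in> carrier_vec mh" "d \<in> carrier_vec mb"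
    and eqs: "(- fp) @\<^sub>v (- fq) = ?J *\<^sub>v (a @\<^sub>v b) + ?B *\<^sub>v (c @\<^sub>v d)"
      "fh @\<^sub>v fb = ?C *\<^sub>v (a @\<^sub>v b) + ?D *\<^sub>v (c @\<^sub>v d)"
    unfolding io_structure_def by blast
  obtain u v where u: "u \<in> carrier_vec Mp" "Ep *\<^sub>v u = a" "Tp *\<^sub>v u = c"
    and v: "v \<in> carrier_vec Mq" "Eq *\<^sub>v v = b" "Tq *\<^sub>v v = d"
    using surj_p[OF ce(1,3)] surj_q[OF ce(2,4)] by auto
  have "fp = Fp *\<^sub>v v \<and> fq = Fq *\<^sub>v u \<and> fh = Sq *\<^sub>v v \<and> fb = Sp *\<^sub>v u"
    using io_equations_iff[OF cf u(1) v(1)] eqs unfolding u v by blast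
  then show "(f, e) \<in> pairs"
    unfolding pairs_def fe using u v by blast
qed

end

section \<open>The input-output representation\<close>

theorem corollary1:
  fixes n p q r :: nat
    and Np Nq Mp Mq Mb Mbh np nq :: nat
    and Pep Peq Pfp Pfq dp dq Tq Tph Sp Sqh :: "real mat"
    and Dbar :: "flow_effort set"
  assumes "p + q = n + 1" and "r = p * q + 1"
    and "Pep \<in> carrier_mat np Mp" and "Peq \<in> carrier_mat nq Mq"
    and "Pfp \<in> carrier_mat np Np" and "Pfq \<in> carrier_mat nq Nq"
    and "dp \<in> carrier_mat Np Mq" and "dq \<in> carrier_mat Nq Mp"
    and "Tq \<in> carrier_mat Mb Mq" and "Tph \<in> carrier_mat Mbh Mp"
    and "Sp \<in> carrier_mat Mb Mp" and "Sqh \<in> carrier_mat Mbh Mq"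
    and "np + nq + Mbh + Mb = Mp + Mq"
    and "(- 1) ^ r \<cdot>\<^sub>m (transpose_mat dp * transpose_mat Pfp * Pep)
           + transpose_mat Peq * Pfq * dq
           + transpose_mat Tq * Sp + transpose_mat Sqh * Tph = 0\<^sub>m Mq Mp"
    and "vec_space.rank (np + Mbh) (Pep @\<^sub>r Tph) = Mp"
    and "vec_space.rank (nq + Mb) (Peq @\<^sub>r Tq) = Mq"
    and "Dbar =
      {(((- 1) ^ r \<cdot>\<^sub>v (Pfp *\<^sub>v (dp *\<^sub>v eq))) @\<^sub>v (Pfq *\<^sub>v (dq *\<^sub>v ep)) @\<^sub>v (Sqh *\<^sub>v eq) @\<^sub>v (Sp *\<^sub>v ep),
        (Pep *\<^sub>v ep) @\<^sub>v (Peq *\<^sub>v eq) @\<^sub>v (Tph *\<^sub>v ep) @\<^sub>v (Tq *\<^sub>v eq)) | ep eq.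
         ep \<in> carrier_vec Mp \<and> eq \<in> carrier_vec Mq}"
  shows "dirac_structure (np + nq + Mbh + Mb) Dbar \<and>
    (\<exists>Jp Jq Bp Bq Cp Cq Dp Dq.
       Jp \<in> carrier_mat np nq \<and> Jq \<in> carrier_mat nq np \<and>
       Bp \<in> carrier_mat np Mb \<and> Bq \<in> carrier_mat nq Mbh \<and>
       Cp \<in> carrier_mat Mb np \<and> Cq \<in> carrier_mat Mbh nq \<and>
       Dp \<in> carrier_mat Mb Mbh \<and> Dq \<in> carrier_mat Mbh Mb \<and>
       (let J = four_block_mat (0\<^sub>m np np) Jp Jq (0\<^sub>m nq nq);
            B = four_block_mat (0\<^sub>m np Mbh) Bp Bq (0\<^sub>m nq Mb);
            C = four_block_mat (0\<^sub>m Mbh np) Cq Cp (0\<^sub>m Mb nq);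
            D = four_block_mat (0\<^sub>m Mbh Mbh) Dq Dp (0\<^sub>m Mb Mb)
        in J = - transpose_mat J \<and> C = transpose_mat B \<and> D = - transpose_mat D \<and>
           Dbar = io_structure np nq Mbh Mb J B C D) \<and>
       Jp = - transpose_mat Jq \<and> Bp = transpose_mat Cp \<and> Bq = transpose_mat Cq \<and>
       Dq = - transpose_mat Dp)"
proof -
  note car = assms(3-12)
  define Fp Fq where F: "Fp = (- 1) ^ r \<cdot>\<^sub>m (Pfp * dp)" "Fq = Pfq * dq"
  have Fc: "Fp \<in> carrier_mat np Mq" "Fq \<in> carrier_mat nq Mp"
    unfolding F using car by auto
  let ?E = "Pep @\<^sub>r Tph" and ?G = "Peq @\<^sub>r Tq" and ?A = "Fp @\<^sub>r Sqh" and ?B = "Fq @\<^sub>r Sp"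
  have E': "?E \<in> carrier_mat (np + Mbh) Mp" and G': "?G \<in> carrier_mat (nq + Mb) Mq"
    and A': "?A \<in> carrier_mat (np + Mbh) Mq" and B': "?B \<in> carrier_mat (nq + Mb) Mp"
    using car Fc by auto
  \<comment> \<open>Full column rank makes both effort matrices at least as high as wide; the dimension
    count then forces them to be square.\<close>
  have dims: "Mp = np + Mbh" "Mq = nq + Mb"
    using vec_space.rank_le_dim_row[OF E'] vec_space.rank_le_dim_row[OF G'] assms(13,15,16) by auto
  note sq = E'[unfolded dims] G'[unfolded dims] A'[unfolded dims] B'[unfolded dims]
  obtain Ei where Ei: "Ei \<in> carrier_mat Mp Mp" "?E * Ei = 1\<^sub>m Mp"
    using full_rank_square_inverse[OF sq(1)] assms(15) dims by metis
  obtain Gi where Gi: "Gi \<in> carrier_mat Mq Mq" "?G * Gi = 1\<^sub>m Mq" "Gi * ?G = 1\<^sub>m Mq"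
    using full_rank_square_inverse[OF sq(2)] assms(16) dims by metis
  have skew: "transpose_mat ?A * ?E + transpose_mat ?G * ?B = 0\<^sub>m Mq Mp"
  proof -
    have FP: "transpose_mat Fp * Pep = (- 1) ^ r \<cdot>\<^sub>m (transpose_mat dp * transpose_mat Pfp * Pep)"
    proof -
      have "transpose_mat Fp = (- 1) ^ r \<cdot>\<^sub>m (transpose_mat dp * transpose_mat Pfp)"
        unfolding F transpose_mult[OF car(3) car(5), symmetric] by (intro eq_matI) auto
      then show ?thesis
        using car by (simp add: mult_smult_assoc_mat[of _ Mq np])
    qed
    have FQ: "transpose_mat Peq * Fq = transpose_mat Peq * Pfq * dq"
      unfolding F using car by (simp add: assoc_mult_mat[of _ Mq nq _ Nq _ Mp])
    have "(W + Z) + (X + Y) = 0\<^sub>m Mq Mp"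
      if "W + X + Y + Z = 0\<^sub>m Mq Mp" "W \<in> carrier_mat Mq Mp" "X \<in> carrier_mat Mq Mp" "Y \<in> carrier_mat Mq Mp"
        "Z \<in> carrier_mat Mq Mp" for W X Y Z :: "real mat"
    proof -
      have "(W + Z) + (X + Y) = W + X + Y + Z"
        using that(2-) by (intro eq_matI) auto
      with that(1) show ?thesis by simp
    qed
    from this[OF assms(14)] have "(transpose_mat Fp * Pep + transpose_mat Sqh * Tph)
        + (transpose_mat Peq * Fq + transpose_mat Tq * Sp) = 0\<^sub>m Mq Mp"
      unfolding FP FQ using car by simp
    then show ?thesis
      unfolding transpose_append_rows_mult[OF Fc(1) car(10) car(1) car(8)]
        transpose_append_rows_mult[OF car(2) car(7) Fc(2) car(9)] .
  qed
  \<comment> \<open>The blocks of this matrix are the blocks of the representation, up to signs and transposes.\<close>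
  obtain K where K: "K \<in> carrier_mat Mp Mq" "K * ?G = ?A" "?B = - (transpose_mat K * ?E)"
    using coupling_matrix[of ?E Mp ?G Mq ?A ?B Gi] sq Gi skew dims by metis
  obtain K11 K12 K21 K22 where split: "split_block K np nq = (K11, K12, K21, K22)"
    by (metis prod_cases4)
  have Kc: "K11 \<in> carrier_mat np nq" "K12 \<in> carrier_mat np Mb" "K21 \<in> carrier_mat Mbh nq"
      "K22 \<in> carrier_mat Mbh Mb" and Kb: "K = four_block_mat K11 K12 K21 K22"
    using split_block[OF split, of Mbh Mb] K(1) dims by auto
  interpret coupled_ports np nq Mbh Mb Mp Mq Fp Fq Sqh Sp Pep Peq Tph Tq K11 K12 K21 K22
  proof
    fix x1 x2 :: "real vec" assume x: "x1 \<in> carrier_vec np" "x2 \<in> carrier_vec Mbh"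
    define u where "u = Ei *\<^sub>v (x1 @\<^sub>v x2)"
    have x12: "x1 @\<^sub>v x2 \<in> carrier_vec Mp" using x dims by simp
    then have u: "u \<in> carrier_vec Mp" unfolding u_def using Ei by simp
    have "?E *\<^sub>v u = x1 @\<^sub>v x2"
      unfolding u_def using Ei x12 E' by (metis assoc_mult_mat_vec one_mult_mat_vec)
    then show "\<exists>u\<in>carrier_vec Mp. Pep *\<^sub>v u = x1 \<and> Tph *\<^sub>v u = x2"
      using u x car by (auto simp: mat_mult_append[OF car(1) car(8) u] append_vec_eq[of _ np])
  next
    fix x1 x2 :: "real vec" assume x: "x1 \<in> carrier_vec nq" "x2 \<in> carrier_vec Mb"
    define u where "u = Gi *\<^sub>v (x1 @\<^sub>v x2)"
    have x12: "x1 @\<^sub>v x2 \<in> carrier_vec Mq" using x dims by simp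
    then have u: "u \<in> carrier_vec Mq" unfolding u_def using Gi by simp
    have "?G *\<^sub>v u = x1 @\<^sub>v x2"
      unfolding u_def using Gi x12 G' by (metis assoc_mult_mat_vec one_mult_mat_vec)
    then show "\<exists>u\<in>carrier_vec Mq. Peq *\<^sub>v u = x1 \<and> Tq *\<^sub>v u = x2"
      using u x car by (auto simp: mat_mult_append[OF car(2) car(7) u] append_vec_eq[of _ nq])
  next
    fix v :: "real vec" assume v: "v \<in> carrier_vec Mq"
    have c: "Peq *\<^sub>v v \<in> carrier_vec nq" "Tq *\<^sub>v v \<in> carrier_vec Mb" using car v by auto
    have "?A *\<^sub>v v = K *\<^sub>v (?G *\<^sub>v v)"
      unfolding K(2)[symmetric] using K(1) G' v dims by (intro assoc_mult_mat_vec) auto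
    then have "(Fp *\<^sub>v v) @\<^sub>v (Sqh *\<^sub>v v) = (K11 *\<^sub>v (Peq *\<^sub>v v) + K12 *\<^sub>v (Tq *\<^sub>v v))
        @\<^sub>v (K21 *\<^sub>v (Peq *\<^sub>v v) + K22 *\<^sub>v (Tq *\<^sub>v v))"
      unfolding Kb mat_mult_append[OF Fc(1) car(10) v] mat_mult_append[OF car(2) car(7) v]
        four_block_mat_mult_vec[OF Kc c] .
    then show "Fp *\<^sub>v v = K11 *\<^sub>v (Peq *\<^sub>v v) + K12 *\<^sub>v (Tq *\<^sub>v v)"
      "Sqh *\<^sub>v v = K21 *\<^sub>v (Peq *\<^sub>v v) + K22 *\<^sub>v (Tq *\<^sub>v v)"
      using Fc Kc c v by (auto simp: append_vec_eq[of _ np])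
  next
    fix u :: "real vec" assume u: "u \<in> carrier_vec Mp"
    have c: "Pep *\<^sub>v u \<in> carrier_vec np" "Tph *\<^sub>v u \<in> carrier_vec Mbh" using car u by auto
    have tc: "transpose_mat K11 \<in> carrier_mat nq np" "transpose_mat K21 \<in> carrier_mat nq Mbh"
      "transpose_mat K12 \<in> carrier_mat Mb np" "transpose_mat K22 \<in> carrier_mat Mb Mbh"
      using Kc by auto
    have "?B *\<^sub>v u = - ((transpose_mat K * ?E) *\<^sub>v u)"
      unfolding K(3) using E' u by (intro uminus_mult_mat_vec) auto
    also have "(transpose_mat K * ?E) *\<^sub>v u = transpose_mat K *\<^sub>v (?E *\<^sub>v u)"
      using K(1) E' u dims by (intro assoc_mult_mat_vec) auto
    finally have "(Fq *\<^sub>v u) @\<^sub>v (Sp *\<^sub>v u) =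
        (- (transpose_mat K11 *\<^sub>v (Pep *\<^sub>v u) + transpose_mat K21 *\<^sub>v (Tph *\<^sub>v u)))
        @\<^sub>v (- (transpose_mat K12 *\<^sub>v (Pep *\<^sub>v u) + transpose_mat K22 *\<^sub>v (Tph *\<^sub>v u)))"
      unfolding Kb mat_mult_append[OF Fc(2) car(9) u] mat_mult_append[OF car(1) car(8) u]
        transpose_four_block_mat[OF Kc] four_block_mat_mult_vec[OF tc c] uminus_append_vec .
    then show "Fq *\<^sub>v u = - (transpose_mat K11 *\<^sub>v (Pep *\<^sub>v u) + transpose_mat K21 *\<^sub>v (Tph *\<^sub>v u))"
      "Sp *\<^sub>v u = - (transpose_mat K12 *\<^sub>v (Pep *\<^sub>v u) + transpose_mat K22 *\<^sub>v (Tph *\<^sub>v u))"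
      using Fc tc c u by (auto simp: append_vec_eq[of _ nq])
  qed (use car Fc Kc in auto)
  have Dbar: "Dbar = pairs"
  proof -
    have "Fp *\<^sub>v v = (- 1) ^ r \<cdot>\<^sub>v (Pfp *\<^sub>v (dp *\<^sub>v v))" if v: "v \<in> carrier_vec Mq" for v
    proof -
      have "(c \<cdot>\<^sub>m M) *\<^sub>v v = c \<cdot>\<^sub>v (M *\<^sub>v v)" if "M \<in> carrier_mat np Mq" for c :: real and M
        using that v by (intro eq_vecI) auto
      from this[of "Pfp * dp" "(- 1) ^ r"] show ?thesis unfolding F using car v by simp
    qed
    moreover have "Fq *\<^sub>v u = Pfq *\<^sub>v (dq *\<^sub>v u)" if "u \<in> carrier_vec Mp" for u
      unfolding F using car that by simp
    ultimately show ?thesis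
      unfolding assms(17) pairs_def by (intro Collect_cong) metis
  qed
  have uminus_zero: "- 0\<^sub>m k l = (0\<^sub>m k l :: real mat)" for k l
    by (intro eq_matI) auto
  show ?thesis
    unfolding Dbar Let_def
  proof (rule conjI, rule pairs_dirac,
      rule exI[of _ "- K11"],
      rule exI[of _ "transpose_mat K11"],
      rule exI[of _ "- K12"],
      rule exI[of _ "transpose_mat K21"],
      rule exI[of _ "- transpose_mat K12"],
      rule exI[of _ "K21"],
      rule exI[of _ "- transpose_mat K22"],
      rule exI[of _ "K22"],
      intro conjI pairs_eq_io_structure)
  qed (use Kc in \<open>simp_all add: transpose_four_block_mat[of _ np np _ nq _ nq]
      transpose_four_block_mat[of _ np Mbh _ Mb _ nq] transpose_four_block_mat[of _ Mbh Mbh _ Mb _ Mb]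
      uminus_four_block_mat[of _ np np _ nq _ nq] uminus_four_block_mat[of _ Mbh Mbh _ Mb _ Mb]
      transpose_uminus uminus_zero\<close>)
qed

end
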